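(* Let $f:\mathbb{R}^n\to\mathbb{R}$ be a twice-differentiable convex function, let $\mathcal{B}=\{\boldsymbol{x}\in\mathbb{R}^n : x_i^L\le x_i\le x_i^U,\ i=1,\dots,n\}$ be a box, let $\boldsymbol{x}_0\in\mathcal{B}$, and let $\varepsilon>0$. Suppose the cutting-plane algorithm described in the context, run on $(f,\mathcal{B},\boldsymbol{x}_0,\varepsilon)$, terminates and returns the value $\alpha^*$. Let $\mathcal{E}$ be the set of all vertices enumerated during the run, i.e. the union of the vertex sets $\mathcal{U}^{(k)}$ over all iterations $k$ of the run, and let $\mathcal{D}$ be the set of all points $\boldsymbol{x}_v$ at which $\alpha$ was decremented, i.e. those that satisfied the condition of Step 5 (with the value of $\alpha$ current at that time) at some iteration of the run. Then $\alpha^*$ is the largest $\alpha\in[0,1]$ such that (i) $q(\boldsymbol{x}_v;\alpha,\boldsymbol{x}_0)\le f(\boldsymbol{x}_v)+\varepsilon$ for every $(\boldsymbol{x}_v,t_v)\in\mathcal{E}$, and (ii) $q(\boldsymbol{x}_v;\alpha,\boldsymbol{x}_0)\le f(\boldsymbol{x}_v)$ for every $\boldsymbol{x}_v\in\mathcal{D}$. That is, $\alpha^*$ satisfies (i) and (ii), and every $\alpha\in[0,1]$ satisfying (i) and (ii) has $\alpha\le\alpha^*$.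
   Context: For $\alpha\in[0,1]$ the scaled second-order Taylor quadratic at $\boldsymbol{x}_0$ is $$q(\boldsymbol{x};\alpha,\boldsymbol{x}_0):=f(\boldsymbol{x}_0)+\nabla f(\boldsymbol{x}_0)(\boldsymbol{x}-\boldsymbol{x}_0)+\tfrac12(\boldsymbol{x}-\boldsymbol{x}_0)^\top\alpha\nabla^2 f(\boldsymbol{x}_0)(\boldsymbol{x}-\boldsymbol{x}_0).$$ Let $\mathcal{V}$ be the set of the $2^n$ vertices of $\mathcal{B}$. Cutting-plane algorithm. Step 1 (Initialize). Set $k=0$, $\alpha^{(0)}=1$, $t^L:=\min_{\boldsymbol{x}\in\mathcal{B}}f(\boldsymbol{x})$, $t^U:=\max_{\boldsymbol{v}\in\mathcal{V}}f(\boldsymbol{v})$, and $\mathcal{A}^{(0)}=\mathcal{U}^{(0)}=\{(\boldsymbol{x},t):\boldsymbol{x}\in\mathcal{V},\ t\in\{t^L,t^U\}\}$. Select a point $(\boldsymbol{x}_p,t_p)\in\mathcal{B}\times[t^L,t^U]$ with $f(\boldsymbol{x}_p)<t_p$ (assumed to exist). Step 2 (Check convergence). Let $LB=\min_{(\boldsymbol{x},t)\in\mathcal{A}^{(k)}}\{t-q(\boldsymbol{x};\alpha^{(k)},\boldsymbol{x}_0)\}$ (with the minimum over the empty set equal to $+\infty$). If $LB>-\varepsilon$, stop and return $\alpha^{(k)}$. Step 3 (Separate vertex). Let $\boldsymbol{u}=(\boldsymbol{x}_u,t_u)$ be a minimizer of $t-q(\boldsymbol{x};\alpha^{(k)},\boldsymbol{x}_0)$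 over $\mathcal{A}^{(k)}$. Let $\boldsymbol{w}=\lambda\boldsymbol{u}+(1-\lambda)(\boldsymbol{x}_p,t_p)$, where $\lambda\in(0,1]$ solves $f(\lambda\boldsymbol{x}_u+(1-\lambda)\boldsymbol{x}_p)-(\lambda t_u+(1-\lambda)t_p)=0$. With $g(\boldsymbol{x},t):=f(\boldsymbol{x})-t$, let $\ell(\boldsymbol{x},t):=g(\boldsymbol{w})+\nabla g(\boldsymbol{w})((\boldsymbol{x},t)-\boldsymbol{w})$; the cut is $\ell(\boldsymbol{x},t)\le 0$. Step 4 (Enumerate vertices). Let $\mathcal{H}^-:=\{(\boldsymbol{x},t)\in\mathcal{U}^{(k)}:\ell(\boldsymbol{x},t)>0\}$ and let $\mathcal{H}^+$ be the set of extreme points of $\{(\boldsymbol{x},t)\in\mathrm{conv}(\mathcal{U}^{(k)}):\ell(\boldsymbol{x},t)\le 0\}$. Set $\mathcal{U}^{(k+1)}=(\mathcal{U}^{(k)}\cup\mathcal{H}^+)\setminus\mathcal{H}^-$. Step 5 (Evaluate underestimation). Consider the points $(\boldsymbol{x}_v,t_v)\in\mathcal{H}^+$ satisfying the condition $f(\boldsymbol{x}_v)-q(\boldsymbol{x}_v;\alpha^{(k)},\boldsymbol{x}_0)<-\varepsilon$. If there are none, leave $\alpha^{(k)}$ unchanged. Otherwise replace $\alpha^{(k)}$ by the minimum over all these points of $$\frac{2\left(f(\boldsymbol{x}_v)-f(\boldsymbol{x}_0)-\nabla f(\boldsymbol{x}_0)(\boldsymbol{x}_v-\boldsymbol{x}_0)\right)}{(\boldsymbol{x}_v-\boldsymbol{x}_0)^\top\nabla^2f(\boldsymbol{x}_0)(\boldsymbol{x}_v-\boldsymbol{x}_0)}$$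 (the denominator is nonzero at such points); in this case $\alpha$ is said to be decremented. Step 6 (Update). With $\alpha^{(k)}$ the value after Step 5, set $\mathcal{A}^{(k+1)}=\{(\boldsymbol{x},t)\in(\mathcal{A}^{(k)}\cup\mathcal{H}^+)\setminus\mathcal{H}^-: t-q(\boldsymbol{x};\alpha^{(k)},\boldsymbol{x}_0)<-\varepsilon\}$ and $\alpha^{(k+1)}=\alpha^{(k)}$. Step 7. Increase $k$ by $1$ and return to Step 2. *)

theory Defs
  imports "HOL-Analysis.Analysis"
begin

definition gradient :: "(real^'n \<Rightarrow> real) \<Rightarrow> real^'n \<Rightarrow> real^'n"
  where "gradient f x = (\<chi> i. frechet_derivative f (at x) (axis i 1))"

definition hessian :: "(real^'n \<Rightarrow> real) \<Rightarrow> real^'n \<Rightarrow> real^'n^'n"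
  where "hessian f x = jacobian (gradient f) (at x)"

definition twice_differentiable :: "(real^'n \<Rightarrow> real) \<Rightarrow> bool"
  where "twice_differentiable f \<longleftrightarrow>
    (\<forall>x. f differentiable (at x)) \<and> (\<forall>x. gradient f differentiable (at x))"

definition q :: "(real^'n \<Rightarrow> real) \<Rightarrow> real^'n \<Rightarrow> real \<Rightarrow> real^'n \<Rightarrow> real"
  where "q f x0 \<alpha> x =
    f x0 + gradient f x0 \<bullet> (x - x0)
      + 1/2 * ((x - x0) \<bullet> ((\<alpha> *\<^sub>R hessian f x0) *v (x - x0)))"

definition box_vertices :: "real^'n \<Rightarrow> real^'n \<Rightarrow> (real^'n) set"
  where "box_vertices xL xU = {v. v extreme_point_of cbox xL xU}"

text \<open>For continuous \<open>f\<close> and a nonempty box the infimum below is attained.\<close>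

definition t_lower :: "(real^'n \<Rightarrow> real) \<Rightarrow> real^'n \<Rightarrow> real^'n \<Rightarrow> real"
  where "t_lower f xL xU = (INF x\<in>cbox xL xU. f x)"

definition t_upper :: "(real^'n \<Rightarrow> real) \<Rightarrow> real^'n \<Rightarrow> real^'n \<Rightarrow> real"
  where "t_upper f xL xU = Max (f ` box_vertices xL xU)"

definition initial_vertices ::
    "(real^'n \<Rightarrow> real) \<Rightarrow> real^'n \<Rightarrow> real^'n \<Rightarrow> ((real^'n) \<times> real) set"
  where "initial_vertices f xL xU =
    box_vertices xL xU \<times> {t_lower f xL xU, t_upper f xL xU}"

definition gap :: "(real^'n \<Rightarrow> real) \<Rightarrow> real^'n \<Rightarrow> real \<Rightarrow> (real^'n) \<times> real \<Rightarrow> real"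
  where "gap f x0 \<alpha> z = snd z - q f x0 \<alpha> (fst z)"

definition LB ::
    "(real^'n \<Rightarrow> real) \<Rightarrow> real^'n \<Rightarrow> real \<Rightarrow> ((real^'n) \<times> real) set \<Rightarrow> ereal"
  where "LB f x0 \<alpha> A = (if A = {} then \<infinity> else ereal (Min (gap f x0 \<alpha> ` A)))"

definition separation_point ::
    "(real^'n \<Rightarrow> real) \<Rightarrow> real^'n \<Rightarrow> (real^'n) \<times> real \<Rightarrow> real
      \<Rightarrow> ((real^'n) \<times> real) set \<Rightarrow> (real^'n) \<times> real \<Rightarrow> bool"
  where "separation_point f x0 p \<alpha> A w \<longleftrightarrow>
    (\<exists>u s. is_arg_min (gap f x0 \<alpha>) (\<lambda>z. z \<in> A) u \<and> 0 < s \<and> s \<le> 1 \<and>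
      f (s *\<^sub>R fst u + (1 - s) *\<^sub>R fst p) - (s * snd u + (1 - s) * snd p) = 0 \<and>
      w = s *\<^sub>R u + (1 - s) *\<^sub>R p)"

definition epi_fun :: "(real^'n \<Rightarrow> real) \<Rightarrow> (real^'n) \<times> real \<Rightarrow> real"
  where "epi_fun f z = f (fst z) - snd z"

definition cut :: "(real^'n \<Rightarrow> real) \<Rightarrow> (real^'n) \<times> real \<Rightarrow> (real^'n) \<times> real \<Rightarrow> real"
  where "cut f w z = epi_fun f w + frechet_derivative (epi_fun f) (at w) (z - w)"

definition H_minus ::
    "(real^'n \<Rightarrow> real) \<Rightarrow> (real^'n) \<times> real \<Rightarrow> ((real^'n) \<times> real) set \<Rightarrow> ((real^'n) \<times> real) set"
  where "H_minus f w U = {z \<in> U. cut f w z > 0}"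

definition H_plus ::
    "(real^'n \<Rightarrow> real) \<Rightarrow> (real^'n) \<times> real \<Rightarrow> ((real^'n) \<times> real) set \<Rightarrow> ((real^'n) \<times> real) set"
  where "H_plus f w U = {z. z extreme_point_of {z \<in> convex hull U. cut f w z \<le> 0}}"

definition decrement_points ::
    "(real^'n \<Rightarrow> real) \<Rightarrow> real^'n \<Rightarrow> real \<Rightarrow> real \<Rightarrow> ((real^'n) \<times> real) set \<Rightarrow> (real^'n) set"
  where "decrement_points f x0 \<epsilon> \<alpha> H = {x \<in> fst ` H. f x - q f x0 \<alpha> x < - \<epsilon>}"

definition decrement_ratio :: "(real^'n \<Rightarrow> real) \<Rightarrow> real^'n \<Rightarrow> real^'n \<Rightarrow> real"
  where "decrement_ratio f x0 x =
    2 * (f x - f x0 - gradient f x0 \<bullet> (x - x0)) / ((x - x0) \<bullet> (hessian f x0 *v (x - x0)))"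

definition update_alpha ::
    "(real^'n \<Rightarrow> real) \<Rightarrow> real^'n \<Rightarrow> real \<Rightarrow> real \<Rightarrow> ((real^'n) \<times> real) set \<Rightarrow> real"
  where "update_alpha f x0 \<epsilon> \<alpha> H =
    (if decrement_points f x0 \<epsilon> \<alpha> H = {} then \<alpha>
     else Min (decrement_ratio f x0 ` decrement_points f x0 \<epsilon> \<alpha> H))"

text \<open>
  A terminating run: \<open>K\<close> is the iteration at which the algorithm stops, and \<open>\<alpha> k\<close>, \<open>A k\<close>, \<open>U k\<close>
  are the values on entry to iteration \<open>k\<close>, so the value of \<open>\<alpha>\<close> after the evaluation step of
  iteration \<open>k\<close> is \<open>\<alpha> (Suc k)\<close>. The points \<open>p\<close> and \<open>w k\<close> (for \<open>k < K\<close>) record the choices made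
  by the algorithm. An iteration in which no separation point exists cannot be continued, and
  so does not occur in a terminating run.
\<close>

definition cutting_plane_run ::
    "(real^'n \<Rightarrow> real) \<Rightarrow> real^'n \<Rightarrow> real^'n \<Rightarrow> real^'n \<Rightarrow> real \<Rightarrow> (real^'n) \<times> real \<Rightarrow> nat
      \<Rightarrow> (nat \<Rightarrow> real) \<Rightarrow> (nat \<Rightarrow> ((real^'n) \<times> real) set) \<Rightarrow> (nat \<Rightarrow> ((real^'n) \<times> real) set)
      \<Rightarrow> (nat \<Rightarrow> (real^'n) \<times> real) \<Rightarrow> bool"
  where "cutting_plane_run f xL xU x0 \<epsilon> p K \<alpha> A U w \<longleftrightarrow>
    p \<in> cbox xL xU \<times> {t_lower f xL xU..t_upper f xL xU} \<and> f (fst p) < snd p \<and>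
    \<alpha> 0 = 1 \<and> A 0 = initial_vertices f xL xU \<and> U 0 = initial_vertices f xL xU \<and>
    (\<forall>k<K.
      \<not> LB f x0 (\<alpha> k) (A k) > ereal (- \<epsilon>) \<and>
      separation_point f x0 p (\<alpha> k) (A k) (w k) \<and>
      U (Suc k) = (U k \<union> H_plus f (w k) (U k)) - H_minus f (w k) (U k) \<and>
      \<alpha> (Suc k) = update_alpha f x0 \<epsilon> (\<alpha> k) (H_plus f (w k) (U k)) \<and>
      A (Suc k) = {z \<in> (A k \<union> H_plus f (w k) (U k)) - H_minus f (w k) (U k).
                     gap f x0 (\<alpha> (Suc k)) z < - \<epsilon>}) \<and>
    LB f x0 (\<alpha> K) (A K) > ereal (- \<epsilon>)"

end

(* A vertex generated by a cut satisfies (i) because of the evaluation step immediately following it,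
   and it continues to do so because alpha only decreases and the Hessian is positive semidefinite.
   For an initial vertex over a corner v, follow (v, t_lower) through the active sets. If it becomes
   inactive because its gap is large, then (i) holds at v since t_lower <= f v. If it is cut off,
   then (v, t_upper) is not, because cuts are tangents of f, so the cut meets the vertical edge
   over v in a point that is extreme in the truncated polytope; hence v is evaluated as well.
   For maximality, the last decrement makes q and f agree at some point of D with positive curvature. *)

theory Submission
  imports Defs
begin

subsection \<open>Differentiable convex functions\<close>

text \<open>Reduces questions along a line to one real variable, where the sign of a derivative at 0
  decides whether a function rises or falls just to the right of 0.\<close>

lemma has_real_derivative_along_line:
  fixes f :: "'a::real_normed_vector \<Rightarrow> real"
  assumes "(f has_derivative f') (at x)"
  shows "((\<lambda>t. f (x + t *\<^sub>R h)) has_real_derivative f' h) (at 0)"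
proof -
  have f: "(f has_derivative f') (at (x + 0 *\<^sub>R h))"
    using assms by simp
  have line: "((\<lambda>t. x + t *\<^sub>R h) has_derivative (\<lambda>t. t *\<^sub>R h)) (at 0)"
    by (auto intro!: derivative_eq_intros)
  have "((\<lambda>t. f (x + t *\<^sub>R h)) has_derivative (\<lambda>t. f' (t *\<^sub>R h))) (at 0)"
    using has_derivative_compose[OF line f] .
  moreover have "linear f'"
    using assms has_derivative_linear by blast
  ultimately show ?thesis
    by (simp add: has_field_derivative_def linear_cmul mult_commute_abs)
qed

text \<open>Subtract from \<open>f\<close> along the segment the rise of its chord. If the tangent
  overshot \<open>f y\<close>, the difference would have positive slope at 0 and so increase at
  first, whereas convexity keeps it at or below its initial value.\<close>

lemma convex_above_tangent:
  fixes f :: "'a::real_normed_vector \<Rightarrow> real"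
  assumes "convex_on UNIV f" and "(f has_derivative f') (at x)"
  shows "f x + f' (y - x) \<le> f y"
proof (rule ccontr)
  define g where "g t = f (x + t *\<^sub>R (y - x)) - t * (f y - f x)" for t
  assume "\<not> ?thesis"
  moreover have "(g has_real_derivative f' (y - x) - (f y - f x)) (at 0)"
    unfolding g_def
    using has_real_derivative_along_line[OF assms(2), of "y - x"]
    by (auto intro!: derivative_eq_intros)
  ultimately obtain d where "d > 0" and d: "\<And>t. 0 < t \<Longrightarrow> t < d \<Longrightarrow> g 0 < g (0 + t)"
    using has_real_derivative_pos_inc_right[of g "f' (y - x) - (f y - f x)" 0 UNIV] by force
  define t where "t = min (d/2) 1"
  have t: "0 < t" "t < d" "t \<le> 1"
    using \<open>d > 0\<close> by (auto simp: t_def)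
  have "x + t *\<^sub>R (y - x) = (1 - t) *\<^sub>R x + t *\<^sub>R y"
    by (simp add: algebra_simps)
  then have "g t \<le> g 0"
    using convex_onD[OF assms(1), of t x y] t by (simp add: g_def algebra_simps)
  then show False
    using d[OF t(1,2)] by simp
qed

lemma has_derivative_gradient:
  fixes f :: "real^'n \<Rightarrow> real"
  assumes "f differentiable (at x)"
  shows "(f has_derivative (\<lambda>h. gradient f x \<bullet> h)) (at x)"
proof -
  let ?D = "frechet_derivative f (at x)"
  have D: "(f has_derivative ?D) (at x)"
    using assms frechet_derivative_works by blast
  then have lin: "linear ?D"
    using has_derivative_linear by blast
  have "?D h = gradient f x \<bullet> h" for h
  proof -
    have "?D h = ?D (\<Sum>i\<in>UNIV. h $ i *\<^sub>R axis i 1)"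
      using basis_expansion[of h] by (simp add: scalar_mult_eq_scaleR)
    also have "\<dots> = (\<Sum>i\<in>UNIV. h $ i * ?D (axis i 1))"
      by (simp add: linear_sum[OF lin] linear_cmul[OF lin])
    finally show ?thesis
      by (simp add: gradient_def inner_vec_def mult.commute)
  qed
  then show ?thesis
    using D by (metis (no_types, lifting) ext)
qed

lemma convex_above_gradient:
  fixes f :: "real^'n \<Rightarrow> real"
  assumes "convex_on UNIV f" and "f differentiable (at x)"
  shows "f x + gradient f x \<bullet> (y - x) \<le> f y"
  using convex_above_tangent[OF assms(1) has_derivative_gradient[OF assms(2)]] .

text \<open>The directional derivative of a convex function is monotone along a line, so the
  derivative of \<open>g\<close> at 0, which is the quadratic form of the Hessian, cannot be
  negative.\<close>

lemma hessian_nonneg: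
  fixes f :: "real^'n \<Rightarrow> real"
  assumes "convex_on UNIV f" and "twice_differentiable f"
  shows "h \<bullet> (hessian f x *v h) \<ge> 0"
proof (rule ccontr)
  define g where "g t = gradient f (x + t *\<^sub>R h) \<bullet> h" for t
  have diff: "f differentiable (at y)" for y
    using assms(2) by (simp add: twice_differentiable_def)
  have "(gradient f has_derivative (\<lambda>k. hessian f x *v k)) (at x)"
    using assms(2) jacobian_works[of "gradient f" "at x"]
    by (simp add: twice_differentiable_def hessian_def)
  then have "((\<lambda>y. gradient f y \<bullet> h) has_derivative (\<lambda>k. (hessian f x *v k) \<bullet> h)) (at x)"
    by (rule has_derivative_inner_left)
  from has_real_derivative_along_line[OF this, of h]
  have "(g has_real_derivative (hessian f x *v h) \<bullet> h) (at 0)"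
    by (simp add: g_def[abs_def])
  moreover assume "\<not> ?thesis"
  ultimately obtain d where "d > 0" and d: "\<And>t. 0 < t \<Longrightarrow> t < d \<Longrightarrow> g (0 + t) < g 0"
    using has_real_derivative_neg_dec_right[of g "(hessian f x *v h) \<bullet> h" 0 UNIV]
    by (force simp: inner_commute)
  define t where "t = d / 2"
  have t: "0 < t" "t < d"
    using \<open>d > 0\<close> by (auto simp: t_def)
  \<comment> \<open>Sum of the tangent inequalities taken at the two ends of the step from
    \<open>x\<close> to \<open>x + t *\<^sub>R h\<close>; the values of \<open>f\<close>
    cancel.\<close>
  have "t * g 0 \<le> t * g t"
    using convex_above_gradient[OF assms(1) diff, of x "x + t *\<^sub>R h"]
      convex_above_gradient[OF assms(1) diff, of "x + t *\<^sub>R h" x]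
    by (simp add: g_def)
  then show False
    using d[OF t] t by simp
qed

subsection \<open>The evaluation step\<close>

text \<open>The denominator in \<open>decrement_ratio\<close>, and twice the slope of
  \<open>q\<close> as an affine function of its scaling parameter.\<close>

definition curvature :: "(real^'n \<Rightarrow> real) \<Rightarrow> real^'n \<Rightarrow> real^'n \<Rightarrow> real"
  where "curvature f x0 x = (x - x0) \<bullet> (hessian f x0 *v (x - x0))"

lemma q_eq:
  "q f x0 a x = f x0 + gradient f x0 \<bullet> (x - x0) + a / 2 * curvature f x0 x"
  by (simp add: q_def curvature_def scaleR_matrix_vector_assoc[symmetric])

lemma q_mono:
  assumes "convex_on UNIV f" and "twice_differentiable f" and "a \<le> b"
  shows "q f x0 a x \<le> q f x0 b x"
  using mult_right_mono[OF assms(3), of "curvature f x0 x / 2"] hessian_nonneg[OF assms(1,2)]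
  by (simp add: q_eq curvature_def)

text \<open>The affine part of \<open>q\<close> lies below \<open>f\<close>, yet \<open>q\<close> at
  \<open>a\<close> exceeds \<open>f\<close> by more than \<epsilon>. Hence the curvature is strictly
  positive, and the ratio is the unique parameter at which \<open>q\<close> and \<open>f\<close>
  agree at \<open>x\<close>.\<close>

lemma decrement_pointD:
  assumes "convex_on UNIV f" and "twice_differentiable f" and "\<epsilon> > 0" and "a \<ge> 0"
    and "x \<in> decrement_points f x0 \<epsilon> a H"
  shows "0 \<le> decrement_ratio f x0 x" and "decrement_ratio f x0 x \<le> a"
    and "q f x0 b x \<le> f x \<longleftrightarrow> b \<le> decrement_ratio f x0 x"
proof -
  let ?C = "curvature f x0 x"
  have lower: "f x0 + gradient f x0 \<bullet> (x - x0) \<le> f x"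
    using assms(1,2) convex_above_gradient by (auto simp: twice_differentiable_def)
  have less: "f x - q f x0 a x < - \<epsilon>"
    using assms(5) by (simp add: decrement_points_def)
  have "0 < a / 2 * ?C"
    using lower less \<open>\<epsilon> > 0\<close> by (simp add: q_eq)
  moreover have "?C \<ge> 0"
    using hessian_nonneg[OF assms(1,2)] by (simp add: curvature_def)
  ultimately have C: "?C > 0"
    by (cases "?C = 0") auto
  have ratio: "decrement_ratio f x0 x = 2 * (f x - f x0 - gradient f x0 \<bullet> (x - x0)) / ?C"
    by (simp add: decrement_ratio_def curvature_def)
  show "0 \<le> decrement_ratio f x0 x"
    using lower C by (simp add: ratio)
  show iff: "q f x0 b x \<le> f x \<longleftrightarrow> b \<le> decrement_ratio f x0 x" for b
    using C by (auto simp: ratio q_eq pos_le_divide_eq)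
  show "decrement_ratio f x0 x \<le> a"
    using iff[of a] less \<open>\<epsilon> > 0\<close> by linarith
qed

lemma finite_decrement_points:
  "finite H \<Longrightarrow> finite (decrement_points f x0 \<epsilon> a H)"
  by (simp add: decrement_points_def)

lemma update_alpha_le_ratio:
  assumes "finite H" and "x \<in> decrement_points f x0 \<epsilon> a H"
  shows "update_alpha f x0 \<epsilon> a H \<le> decrement_ratio f x0 x"
  using assms finite_decrement_points[OF assms(1)] by (auto simp: update_alpha_def)

text \<open>A minimum over finitely many ratios is attained; the attaining point later witnesses
  maximality.\<close>

lemma update_alpha_cases:
  assumes "finite H"
  obtains "decrement_points f x0 \<epsilon> a H = {}" "update_alpha f x0 \<epsilon> a H = a"
  | x where "x \<in> decrement_points f x0 \<epsilon> a H"
      "update_alpha f x0 \<epsilon> a H = decrement_ratio f x0 x"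
proof (cases "decrement_points f x0 \<epsilon> a H = {}")
  case True
  then show thesis
    using that(1) by (simp add: update_alpha_def)
next
  case False
  then have "update_alpha f x0 \<epsilon> a H \<in> decrement_ratio f x0 ` decrement_points f x0 \<epsilon> a H"
    using Min_in finite_decrement_points[OF assms] by (simp add: update_alpha_def)
  then show thesis
    using that(2) by blast
qed

lemma update_alpha_bounds:
  assumes "convex_on UNIV f" and "twice_differentiable f" and "\<epsilon> > 0" and "a \<ge> 0"
    and "finite H"
  shows "0 \<le> update_alpha f x0 \<epsilon> a H" and "update_alpha f x0 \<epsilon> a H \<le> a"
  using update_alpha_cases[OF assms(5), of f x0 \<epsilon> a] decrement_pointD(1,2)[OF assms(1-4)] assms(4)
  by (metis, metis order_refl)

lemma q_update_alpha_le_decrement_point: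
  assumes "convex_on UNIV f" and "twice_differentiable f" and "\<epsilon> > 0" and "a \<ge> 0"
    and "finite H" and "x \<in> decrement_points f x0 \<epsilon> a H"
  shows "q f x0 (update_alpha f x0 \<epsilon> a H) x \<le> f x"
  using decrement_pointD(3)[OF assms(1-4,6)] update_alpha_le_ratio[OF assms(5,6)] by blast

text \<open>An evaluated point either triggers a decrement, after which \<open>q\<close> is at most
  \<open>f\<close> there, or was already within \<epsilon> and stays so when the parameter
  shrinks.\<close>

lemma q_update_alpha_le:
  assumes "convex_on UNIV f" and "twice_differentiable f" and "\<epsilon> > 0" and "a \<ge> 0"
    and "finite H" and "x \<in> fst ` H"
  shows "q f x0 (update_alpha f x0 \<epsilon> a H) x \<le> f x + \<epsilon>"
proof (cases "x \<in> decrement_points f x0 \<epsilon> a H")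
  case True
  then show ?thesis
    using q_update_alpha_le_decrement_point[OF assms(1-5)] \<open>\<epsilon> > 0\<close> by force
next
  case False
  then have "q f x0 a x \<le> f x + \<epsilon>"
    using assms(6) by (auto simp: decrement_points_def)
  then show ?thesis
    using q_mono[OF assms(1,2) update_alpha_bounds(2)[OF assms(1-5)]] order_trans by blast
qed

subsection \<open>Cuts\<close>

text \<open>The terms in \<open>snd w\<close> cancel, so the cut is the region on or above the
  tangent plane of \<open>f\<close> at \<open>fst w\<close>.\<close>

lemma cut_eq:
  assumes "f differentiable (at (fst w))"
  shows "cut f w z = f (fst w) + gradient f (fst w) \<bullet> (fst z - fst w) - snd z"
proof -
  have "((\<lambda>z. f (fst z)) has_derivative (\<lambda>h. gradient f (fst w) \<bullet> fst h)) (at w)"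
    using has_derivative_compose[OF has_derivative_fst[OF has_derivative_ident]]
      has_derivative_gradient[OF assms] by blast
  then have "(epi_fun f has_derivative (\<lambda>h. gradient f (fst w) \<bullet> fst h - snd h)) (at w)"
    unfolding epi_fun_def[abs_def]
    by (intro has_derivative_diff has_derivative_snd has_derivative_ident)
  from frechet_derivative_at[OF this, symmetric] show ?thesis
    by (simp add: cut_def epi_fun_def)
qed

text \<open>The cut is a halfspace with normal \<open>(gradient f (fst w), -1)\<close>, so the
  truncated hull is a polyhedron. Finiteness makes the \<open>Min\<close> in
  \<open>update_alpha\<close> an attained minimum.\<close>

lemma finite_H_plus:
  assumes "f differentiable (at (fst w))" and "finite U"
  shows "finite (H_plus f w U)"
proof -
  have "{z. cut f w z \<le> 0} =
      {z. (gradient f (fst w), -1) \<bullet> z \<le> gradient f (fst w) \<bullet> fst w - f (fst w)}"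
    by (auto simp: cut_eq[OF assms(1)] inner_diff_right inner_Pair_0 inner_prod_def)
  then have "polyhedron {z. cut f w z \<le> 0}"
    using polyhedron_halfspace_le by metis
  moreover have "polyhedron (convex hull U)"
    using polytope_convex_hull[OF assms(2)] polytope_imp_polyhedron by blast
  ultimately have "polyhedron (convex hull U \<inter> {z. cut f w z \<le> 0})"
    by blast
  from finite_polyhedron_extreme_points[OF this] show ?thesis
    by (simp add: H_plus_def Int_def)
qed

lemma H_plus_subset: "H_plus f w U \<subseteq> convex hull U"
  by (auto simp: H_plus_def extreme_point_of_def)

lemma fst_convex_hull_subset:
  assumes "fst ` U \<subseteq> C" and "convex C"
  shows "fst ` (convex hull U) \<subseteq> C"
  using assms hull_minimal[of "fst ` U" C convex]
  by (simp add: convex_hull_linear_image[OF linear_fst])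

lemma extreme_point_not_between:
  fixes v :: "'a::real_vector"
  assumes "v extreme_point_of C" and "a \<in> C" and "b \<in> C"
    and "v = (1 - t) *\<^sub>R a + t *\<^sub>R b" and "0 < t" and "t < 1"
  shows "a = v" and "b = v"
proof -
  have "a = b"
    using assms unfolding extreme_point_of_def in_segment by blast
  then show "a = v" "b = v"
    using assms(4) by (auto simp: algebra_simps)
qed

text \<open>Over \<open>v\<close> the cut reads \<open>r - y\<close> at height \<open>y\<close>, so
  it meets the edge at height \<open>r\<close>. Any segment of the truncated hull through
  \<open>(v, r)\<close> is vertical because \<open>v\<close> is extreme in \<open>C\<close>, and the
  cut forbids heights below \<open>r\<close>; thus \<open>(v, r)\<close> is extreme.\<close>

lemma cut_vertical_edge:
  fixes f :: "real^'n \<Rightarrow> real"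
  assumes diff: "f differentiable (at (fst w))"
    and C: "fst ` U \<subseteq> C" "convex C" and v: "v extreme_point_of C"
    and low: "(v, s) \<in> U" "cut f w (v, s) > 0"
    and upp: "(v, t) \<in> U" "cut f w (v, t) \<le> 0"
  shows "v \<in> fst ` H_plus f w U"
proof -
  define r where "r = f (fst w) + gradient f (fst w) \<bullet> (v - fst w)"
  let ?P = "{z \<in> convex hull U. cut f w z \<le> 0}"
  have cut: "cut f w (v, y) = r - y" for y
    by (simp add: cut_eq[OF diff] r_def)
  have st: "s < r" "r \<le> t"
    using low(2) upp(2) by (simp_all add: cut)
  \<comment> \<open>The parameter at which the edge from height \<open>s\<close> to height
    \<open>t\<close> reaches \<open>r\<close>; it equals 1 when the upper end lies exactly on the
    cut.\<close>
  define l where "l = (r - s) / (t - s)"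
  have "l * (t - s) = r - s"
    using st by (simp add: l_def)
  then have "(v, r) = (1 - l) *\<^sub>R (v, s) + l *\<^sub>R (v, t)"
    by (simp add: algebra_simps)
  moreover have "0 \<le> l" "l \<le> 1"
    using st by (auto simp: l_def)
  ultimately have "(v, r) \<in> convex hull U"
    using convexD_alt[OF convex_convex_hull hull_inc[OF low(1)] hull_inc[OF upp(1)]] by metis
  then have mem: "(v, r) \<in> ?P"
    by (simp add: cut)
  have "(v, r) \<notin> open_segment a b" if a: "a \<in> ?P" and b: "b \<in> ?P" for a b
  proof
    assume "(v, r) \<in> open_segment a b"
    then obtain u where "a \<noteq> b" and u: "0 < u" "u < 1"
      and eq: "(v, r) = (1 - u) *\<^sub>R a + u *\<^sub>R b"
      by (auto simp: in_segment)
    have "fst a \<in> C" "fst b \<in> C"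
      using a b fst_convex_hull_subset[OF C] by auto
    moreover have "v = (1 - u) *\<^sub>R fst a + u *\<^sub>R fst b"
      using eq by (metis fst_conv fst_add fst_scaleR)
    ultimately have fst: "fst a = v" "fst b = v"
      using extreme_point_not_between[OF v] u by blast+
    then have "r \<le> snd a" "r \<le> snd b"
      using a b cut by (metis (mono_tags) diff_le_0_iff_le mem_Collect_eq prod.collapse)+
    moreover have "r = (1 - u) * snd a + u * snd b"
      using eq by (metis snd_conv snd_add snd_scaleR real_scaleR_def)
    \<comment> \<open>Two nonnegative excesses with positive weights sum to zero, so both
      vanish.\<close>
    then have "(1 - u) * (snd a - r) + u * (snd b - r) = 0"
      by (simp add: algebra_simps)
    ultimately have "snd a = r" "snd b = r"
      using u by (auto simp: add_nonneg_eq_0_iff)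
    then show False
      using fst \<open>a \<noteq> b\<close> by (simp add: prod_eq_iff)
  qed
  then have "(v, r) \<in> H_plus f w U"
    using mem by (simp add: H_plus_def extreme_point_of_def)
  then show ?thesis
    by force
qed

subsection \<open>The initial vertices\<close>

lemma finite_box_vertices: "finite (box_vertices xL xU)"
  unfolding box_vertices_def
  by (intro finite_polyhedron_extreme_points polytope_imp_polyhedron polytope_interval)

lemma box_vertices_subset: "box_vertices xL xU \<subseteq> cbox xL xU"
  by (auto simp: box_vertices_def extreme_point_of_def)

lemma t_upper_ge: "v \<in> box_vertices xL xU \<Longrightarrow> f v \<le> t_upper f xL xU"
  by (simp add: t_upper_def finite_box_vertices)

lemma t_lower_le:
  assumes "continuous_on (cbox xL xU) f" and "x \<in> cbox xL xU"
  shows "t_lower f xL xU \<le> f x"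
  unfolding t_lower_def
  using assms compact_continuous_image[OF assms(1) compact_cbox]
  by (intro cINF_lower bounded_imp_bdd_below compact_imp_bounded)

subsection \<open>Runs\<close>

lemma LB_gt_imp_gap_gt:
  assumes "LB f x0 a A > ereal (- \<epsilon>)" and "finite A" and "z \<in> A"
  shows "gap f x0 a z > - \<epsilon>"
  using assms by (auto simp: LB_def split: if_splits)

text \<open>Points of \<open>U k\<close> not over a corner were produced by a cut and hence
  evaluated. Corners may still violate (i) during the run, but only while their lower copy is
  active; their upper copies persist to serve as the far ends of vertical edges. The last two
  clauses carry (ii) and a witness for maximality.\<close>

lemma cutting_plane_run_invariants:
  fixes f :: "real^'n \<Rightarrow> real"
  assumes twice: "twice_differentiable f" and convex: "convex_on UNIV f" and eps: "\<epsilon> > 0"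
    and run: "cutting_plane_run f xL xU x0 \<epsilon> p K \<alpha> A U w"
    and "k \<le> K"
  shows "finite (U k) \<and> A k \<subseteq> U k \<and> fst ` U k \<subseteq> cbox xL xU \<and> 0 \<le> \<alpha> k \<and> \<alpha> k \<le> 1
    \<and> (\<forall>v\<in>box_vertices xL xU. (v, t_upper f xL xU) \<in> U k \<and>
        ((v, t_lower f xL xU) \<in> A k \<or> q f x0 (\<alpha> k) v \<le> f v + \<epsilon>))
    \<and> (\<forall>z\<in>U k. fst z \<in> box_vertices xL xU \<or> q f x0 (\<alpha> k) (fst z) \<le> f (fst z) + \<epsilon>)
    \<and> (\<forall>j<k. \<forall>x \<in> decrement_points f x0 \<epsilon> (\<alpha> j) (H_plus f (w j) (U j)).
          q f x0 (\<alpha> k) x \<le> f x)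
    \<and> (\<alpha> k = 1 \<or> (\<exists>j<k. \<exists>x \<in> decrement_points f x0 \<epsilon> (\<alpha> j) (H_plus f (w j) (U j)).
          \<forall>a. q f x0 a x \<le> f x \<longrightarrow> a \<le> \<alpha> k))"
  using \<open>k \<le> K\<close>
proof (induction k)
  case 0
  have init: "\<alpha> 0 = 1" "A 0 = initial_vertices f xL xU" "U 0 = initial_vertices f xL xU"
    using run by (auto simp: cutting_plane_run_def)
  show ?case
    using box_vertices_subset
    by (auto simp: init initial_vertices_def intro!: finite_cartesian_product finite_box_vertices)
next
  case (Suc k)
  let ?H = "H_plus f (w k) (U k)" and ?M = "H_minus f (w k) (U k)"
  have diff: "f differentiable (at y)" for y
    using twice by (simp add: twice_differentiable_def)
  have U: "U (Suc k) = (U k \<union> ?H) - ?M"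
    and \<alpha>: "\<alpha> (Suc k) = update_alpha f x0 \<epsilon> (\<alpha> k) ?H"
    and A: "A (Suc k) = {z \<in> (A k \<union> ?H) - ?M. gap f x0 (\<alpha> (Suc k)) z < - \<epsilon>}"
    using run Suc.prems by (auto simp: cutting_plane_run_def)
  have fin: "finite (U k)" and AU: "A k \<subseteq> U k" and box: "fst ` U k \<subseteq> cbox xL xU"
    and \<alpha>0: "0 \<le> \<alpha> k" and \<alpha>1: "\<alpha> k \<le> 1"
    and upper: "\<And>v. v \<in> box_vertices xL xU \<Longrightarrow> (v, t_upper f xL xU) \<in> U k"
    and corner: "\<And>v. v \<in> box_vertices xL xU \<Longrightarrow>
      (v, t_lower f xL xU) \<in> A k \<or> q f x0 (\<alpha> k) v \<le> f v + \<epsilon>"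
    and vert: "\<And>z. z \<in> U k \<Longrightarrow>
      fst z \<in> box_vertices xL xU \<or> q f x0 (\<alpha> k) (fst z) \<le> f (fst z) + \<epsilon>"
    and dec: "\<And>j x. j < k \<Longrightarrow> x \<in> decrement_points f x0 \<epsilon> (\<alpha> j) (H_plus f (w j) (U j)) \<Longrightarrow>
      q f x0 (\<alpha> k) x \<le> f x"
    and tight: "\<alpha> k = 1 \<or> (\<exists>j<k. \<exists>x \<in> decrement_points f x0 \<epsilon> (\<alpha> j) (H_plus f (w j) (U j)).
      \<forall>a. q f x0 a x \<le> f x \<longrightarrow> a \<le> \<alpha> k)"
    using Suc.IH Suc.prems by auto
  have finH: "finite ?H"
    using finite_H_plus[OF diff fin] .
  have new: "q f x0 (\<alpha> (Suc k)) x \<le> f x + \<epsilon>" if "x \<in> fst ` ?H" for x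
    unfolding \<alpha> using q_update_alpha_le[OF convex twice eps \<alpha>0 finH that] .
  have bounds: "0 \<le> \<alpha> (Suc k)" "\<alpha> (Suc k) \<le> \<alpha> k"
    unfolding \<alpha> using update_alpha_bounds[OF convex twice eps \<alpha>0 finH] by auto
  have mono: "q f x0 (\<alpha> (Suc k)) x \<le> q f x0 (\<alpha> k) x" for x
    using q_mono[OF convex twice bounds(2)] .
  \<comment> \<open>At a corner the tangent plane lies below \<open>f v\<close>, which is at most
    \<open>t_upper\<close>.\<close>
  have uncut: "cut f (w k) (v, t_upper f xL xU) \<le> 0" if "v \<in> box_vertices xL xU" for v
    using convex_above_gradient[OF convex diff, of "fst (w k)" v] t_upper_ge[OF that, of f]
    by (simp add: cut_eq[OF diff])
  have corner': "(v, t_lower f xL xU) \<in> A (Suc k) \<or> q f x0 (\<alpha> (Suc k)) v \<le> f v + \<epsilon>"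
    if v: "v \<in> box_vertices xL xU" for v
  proof (cases "(v, t_lower f xL xU) \<in> A k")
    case False
    then show ?thesis
      using corner[OF v] mono[of v] by linarith
  next
    case True
    show ?thesis
    proof (cases "(v, t_lower f xL xU) \<in> ?M")
      case True
      then have "v \<in> fst ` ?H"
        using cut_vertical_edge[OF diff box convex_box(1), of v "t_lower f xL xU" "w k"]
          v uncut[OF v] upper[OF v]
        by (auto simp: H_minus_def box_vertices_def)
      then show ?thesis
        using new by blast
    next
      case False
      \<comment> \<open>The lower copy is not cut off, so it leaves the active set only if its gap
        is at least \<open>- \<epsilon>\<close>; then \<open>t_lower \<le> f v\<close> turns the gap
        bound into (i) at \<open>v\<close>.\<close>
      have "continuous_on (cbox xL xU) f"
        using diff differentiable_at_imp_differentiable_on differentiable_imp_continuous_on by blast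
      then have "t_lower f xL xU \<le> f v"
        using t_lower_le v box_vertices_subset by blast
      then show ?thesis
        using False \<open>(v, t_lower f xL xU) \<in> A k\<close> by (auto simp: A gap_def)
    qed
  qed
  have "finite (U (Suc k))"
    using fin finH by (simp add: U)
  moreover have "A (Suc k) \<subseteq> U (Suc k)"
    using AU by (auto simp: A U)
  moreover have "fst ` U (Suc k) \<subseteq> cbox xL xU"
    using box fst_convex_hull_subset[OF box convex_box(1)] H_plus_subset[of f "w k" "U k"]
    unfolding U by blast
  moreover have "(v, t_upper f xL xU) \<in> U (Suc k)" if "v \<in> box_vertices xL xU" for v
    using upper[OF that] uncut[OF that] by (auto simp: U H_minus_def)
  moreover have "fst z \<in> box_vertices xL xU \<or> q f x0 (\<alpha> (Suc k)) (fst z) \<le> f (fst z) + \<epsilon>"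
    if "z \<in> U (Suc k)" for z
    using that vert[of z] mono[of "fst z"] new[of "fst z"] by (force simp: U)
  moreover have "q f x0 (\<alpha> (Suc k)) x \<le> f x"
    if "j < Suc k" "x \<in> decrement_points f x0 \<epsilon> (\<alpha> j) (H_plus f (w j) (U j))" for j x
  proof (cases "j = k")
    case True
    then show ?thesis
      using that q_update_alpha_le_decrement_point[OF convex twice eps \<alpha>0 finH] by (simp add: \<alpha>)
  next
    case False
    then show ?thesis
      using that dec[of j x] mono[of x] by linarith
  qed
  \<comment> \<open>Without a decrement the old witness carries over; with one, the point attaining
    the minimal ratio replaces it.\<close>
  moreover have "\<alpha> (Suc k) = 1 \<or>
    (\<exists>j<Suc k. \<exists>x \<in> decrement_points f x0 \<epsilon> (\<alpha> j) (H_plus f (w j) (U j)).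
      \<forall>a. q f x0 a x \<le> f x \<longrightarrow> a \<le> \<alpha> (Suc k))"
    using finH
  proof (cases rule: update_alpha_cases[of ?H f x0 \<epsilon> "\<alpha> k"])
    case 1
    then show ?thesis
      using tight unfolding \<alpha> by (metis less_SucI)
  next
    case (2 x)
    then show ?thesis
      using decrement_pointD(3)[OF convex twice eps \<alpha>0 2(1)] unfolding \<alpha> by auto
  qed
  ultimately show ?case
    using bounds \<alpha>1 corner' by auto
qed

text \<open>Needed for vertices that a later cut removes from \<open>U\<close>: their bound is known
  at an earlier iteration and must be carried to the final parameter.\<close>

lemma cutting_plane_run_decreasing:
  fixes f :: "real^'n \<Rightarrow> real"
  assumes "twice_differentiable f" and "convex_on UNIV f" and "\<epsilon> > 0"
    and run: "cutting_plane_run f xL xU x0 \<epsilon> p K \<alpha> A U w"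
    and "j \<le> k" and "k \<le> K"
  shows "\<alpha> k \<le> \<alpha> j"
  using \<open>j \<le> k\<close> \<open>k \<le> K\<close>
proof (induction k rule: dec_induct)
  case (step k)
  have "f differentiable (at y)" for y
    using assms(1) by (simp add: twice_differentiable_def)
  moreover have "finite (U k)" "0 \<le> \<alpha> k"
    using cutting_plane_run_invariants[OF assms(1-4), of k] step.prems by auto
  moreover have "\<alpha> (Suc k) = update_alpha f x0 \<epsilon> (\<alpha> k) (H_plus f (w k) (U k))"
    using run step.prems by (auto simp: cutting_plane_run_def)
  ultimately have "\<alpha> (Suc k) \<le> \<alpha> k"
    using update_alpha_bounds(2)[OF assms(2,1,3)] finite_H_plus by metis
  then show ?case
    using step by linarith
qed simp

section \<open>Feasibility and maximality of the returned value\<close>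

theorem mainTheorem1:
  fixes f :: "real^'n \<Rightarrow> real" and xL xU x0 :: "real^'n" and \<epsilon> \<alpha>_star :: real
    and p :: "(real^'n) \<times> real" and K :: nat and \<alpha> :: "nat \<Rightarrow> real"
    and A U :: "nat \<Rightarrow> ((real^'n) \<times> real) set" and w :: "nat \<Rightarrow> (real^'n) \<times> real"
    and E :: "((real^'n) \<times> real) set" and D :: "(real^'n) set"
  assumes "twice_differentiable f" and "convex_on UNIV f"
    and "x0 \<in> cbox xL xU" and "\<epsilon> > 0"
    and "cutting_plane_run f xL xU x0 \<epsilon> p K \<alpha> A U w"
    and "\<alpha>_star = \<alpha> K"
    and "E = (\<Union>k\<le>K. U k)"
    and "D = (\<Union>k<K. decrement_points f x0 \<epsilon> (\<alpha> k) (H_plus f (w k) (U k)))"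
  shows "\<alpha>_star \<in> {0..1}
    \<and> (\<forall>(xv, tv)\<in>E. q f x0 \<alpha>_star xv \<le> f xv + \<epsilon>)
    \<and> (\<forall>xv\<in>D. q f x0 \<alpha>_star xv \<le> f xv)
    \<and> (\<forall>a\<in>{0..1}.
          (\<forall>(xv, tv)\<in>E. q f x0 a xv \<le> f xv + \<epsilon>) \<and> (\<forall>xv\<in>D. q f x0 a xv \<le> f xv)
          \<longrightarrow> a \<le> \<alpha>_star)"
proof -
  note inv = cutting_plane_run_invariants[OF assms(1,2,4,5)]
  note K = inv[OF order_refl]
  have corner: "q f x0 (\<alpha> K) v \<le> f v + \<epsilon>" if v: "v \<in> box_vertices xL xU" for v
  proof (cases "(v, t_lower f xL xU) \<in> A K")
    case True
    \<comment> \<open>A lower copy still active at termination is controlled by the stopping test,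
      since every gap in \<open>A K\<close> exceeds \<open>- \<epsilon>\<close>.\<close>
    have "finite (A K)"
      using K finite_subset by blast
    moreover have "LB f x0 (\<alpha> K) (A K) > ereal (- \<epsilon>)"
      using assms(5) by (simp add: cutting_plane_run_def)
    ultimately have "gap f x0 (\<alpha> K) (v, t_lower f xL xU) > - \<epsilon>"
      using LB_gt_imp_gap_gt True by blast
    moreover have "continuous_on (cbox xL xU) f"
      using assms(1) differentiable_at_imp_differentiable_on differentiable_imp_continuous_on
      unfolding twice_differentiable_def by blast
    then have "t_lower f xL xU \<le> f v"
      using t_lower_le v box_vertices_subset by blast
    ultimately show ?thesis
      by (simp add: gap_def)
  next
    case False
    then show ?thesis
      using K v by blast
  qed
  have E: "q f x0 (\<alpha> K) xv \<le> f xv + \<epsilon>" if xv: "(xv, tv) \<in> E" for xv tv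
  proof -
    obtain k where k: "k \<le> K" "(xv, tv) \<in> U k"
      using xv assms(7) by blast
    have "q f x0 (\<alpha> K) xv \<le> q f x0 (\<alpha> k) xv"
      using q_mono[OF assms(2,1)] cutting_plane_run_decreasing[OF assms(1,2,4,5) k(1)] by blast
    moreover have "xv \<in> box_vertices xL xU \<or> q f x0 (\<alpha> k) xv \<le> f xv + \<epsilon>"
      using inv[OF k(1)] k(2) by (metis fst_conv)
    ultimately show ?thesis
      using corner[of xv] by linarith
  qed
  have D: "q f x0 (\<alpha> K) xv \<le> f xv" if "xv \<in> D" for xv
    using that K assms(8) by blast
  \<comment> \<open>Either the returned value is the top of \<open>{0..1}\<close>, or some point of
    \<open>D\<close> already caps every parameter satisfying (ii).\<close>
  have "\<alpha> K = 1 \<or> (\<exists>x\<in>D. \<forall>a. q f x0 a x \<le> f x \<longrightarrow> a \<le> \<alpha> K)"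
    using K assms(8) by blast
  then have "a \<le> \<alpha> K" if "a \<in> {0..1}" "\<forall>xv\<in>D. q f x0 a xv \<le> f xv" for a
    using that by auto
  then show ?thesis
    using E D K assms(6) by auto
qed

end
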